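(* Let $$\mathcal G_0=\begin{pmatrix} A & B_1 & B_2 & \cdots & B_m \\ {B_1^\dagger} & C_{11} & C_{12} & \cdots & C_{1m} \\ {B_2^\dagger} & C_{21} & C_{22} & \cdots & C_{2m} \\ \vdots & \vdots & \vdots & \ddots & \vdots \\ {B_m^\dagger} & C_{m1} & C_{m2} & \cdots & C_{mm} \end{pmatrix}\ge0$$ be a positive semidefinite complex block matrix, where $A\ge0$ acts on $\mathbb C^d$ and has rank $r<d$. Then $$\operatorname{Ran}B_\alpha\subseteq\operatorname{Ran}A\qquad\text{for every }\alpha=1,\dots,m .$$ Equivalently, $\operatorname{rank}[A\ B_\alpha]\le r$ for every $\alpha$. These are algebraic constraints, given by the vanishing of all $(r+1)\times(r+1)$ minors of $[A\ B_\alpha]$.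
   Context: $\operatorname{Ran}$ denotes the range (column space) and $[A\ B_\alpha]$ horizontal concatenation. (In the application, $\mathcal G_0$ is a principal Gram block required by a proposed pattern of simultaneous saturation of several coherence-transfer bounds.) *)

theory Defs
  imports
    "Jordan_Normal_Form.Schur_Decomposition"
    "Jordan_Normal_Form.DL_Rank_Submatrix"
begin

definition append_cols :: "'a :: zero mat \<Rightarrow> 'a mat \<Rightarrow> 'a mat" where
  "append_cols X Y = four_block_mat X Y (0\<^sub>m 0 (dim_col X)) (0\<^sub>m 0 (dim_col Y))"

text \<open>The extra argument of \<open>hcat\<close> (\<open>vcat\<close>) is the common number of rows (columns) of the
  listed matrices; it is what determines the concatenation of the empty list.\<close>

definition hcat :: "nat \<Rightarrow> 'a :: zero mat list \<Rightarrow> 'a mat" where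
  "hcat r Xs = foldr append_cols Xs (0\<^sub>m r 0)"

definition vcat :: "nat \<Rightarrow> 'a :: zero mat list \<Rightarrow> 'a mat" where
  "vcat c Xs = foldr append_rows Xs (0\<^sub>m 0 c)"

text \<open>The \<open>k \<times> k\<close> block matrix whose block in position \<open>(p, q)\<close>, \<open>p, q < k\<close>, is
  \<open>F p q\<close>, of dimension \<open>s p \<times> s q\<close>.\<close>

definition block_mat :: "nat \<Rightarrow> (nat \<Rightarrow> nat) \<Rightarrow> (nat \<Rightarrow> nat \<Rightarrow> 'a :: zero mat) \<Rightarrow> 'a mat" where
  "block_mat k s F =
     vcat (\<Sum>q<k. s q) (map (\<lambda>p. hcat (s p) (map (F p) [0..<k])) [0..<k])"

text \<open>The order on \<^typ>\<open>complex\<close> makes \<open>0 \<le> z\<close> say that \<open>z\<close> is real and nonnegative;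
  \<open>(M *\<^sub>v v) \<bullet>c v\<close> is \<open>v\<^sup>\<dagger> M v\<close>.\<close>

definition pos_semidef :: "complex mat \<Rightarrow> bool" where
  "pos_semidef M \<longleftrightarrow> square_mat M \<and> mat_adjoint M = M \<and>
     (\<forall>v \<in> carrier_vec (dim_row M). 0 \<le> (M *\<^sub>v v) \<bullet>c v)"

text \<open>The block matrix with first row \<open>A, B\<^sub>1, \<dots>, B\<^sub>m\<close>, first column
  \<open>A, B\<^sub>1\<^sup>\<dagger>, \<dots>, B\<^sub>m\<^sup>\<dagger>\<close> and remaining blocks \<open>C\<^sub>\<alpha>\<^sub>\<beta>\<close>. Block 0 has size \<open>d\<close>, block
  \<open>\<alpha>\<close> with \<open>1 \<le> \<alpha> \<le> m\<close> has size \<open>n \<alpha>\<close>.\<close>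

definition bordered_mat ::
  "nat \<Rightarrow> nat \<Rightarrow> (nat \<Rightarrow> nat) \<Rightarrow> complex mat \<Rightarrow> (nat \<Rightarrow> complex mat) \<Rightarrow>
   (nat \<Rightarrow> nat \<Rightarrow> complex mat) \<Rightarrow> complex mat" where
  "bordered_mat d m n A B C =
     block_mat (Suc m) (\<lambda>p. if p = 0 then d else n p)
       (\<lambda>p q. if p = 0 \<and> q = 0 then A
              else if p = 0 then B q
              else if q = 0 then mat_adjoint (B p)
              else C p q)"

definition minors :: "nat \<Rightarrow> 'a :: comm_ring_1 mat \<Rightarrow> 'a set" where
  "minors k M = {det (submatrix M I J) | I J.
     I \<subseteq> {..<dim_row M} \<and> card I = k \<and> J \<subseteq> {..<dim_col M} \<and> card J = k}"

lemma append_cols_carrier: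
  "X \<in> carrier_mat r a \<Longrightarrow> Y \<in> carrier_mat r b \<Longrightarrow> append_cols X Y \<in> carrier_mat r (a + b)"
  by (auto simp: append_cols_def)

lemma append_cols_index:
  assumes "X \<in> carrier_mat r a" "Y \<in> carrier_mat r b" "i < r" "j < a + b"
  shows "append_cols X Y $$ (i, j) = (if j < a then X $$ (i, j) else Y $$ (i, j - a))"
  using assms by (auto simp: append_cols_def)

lemma append_rows_index:
  assumes "X \<in> carrier_mat a c" "Y \<in> carrier_mat b c" "i < a + b" "j < c"
  shows "append_rows X Y $$ (i, j) = (if i < a then X $$ (i, j) else Y $$ (i - a, j))"
  using assms by (auto simp: append_rows_def)

lemma hcat_carrier:
  assumes "\<forall>X \<in> set Xs. dim_row X = r"
  shows "hcat r Xs \<in> carrier_mat r (sum_list (map dim_col Xs))"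
  using assms
proof (induction Xs)
  case (Cons X Xs)
  have "X \<in> carrier_mat r (dim_col X)" using Cons.prems by auto
  moreover have "hcat r Xs \<in> carrier_mat r (sum_list (map dim_col Xs))"
    by (rule Cons.IH) (use Cons.prems in simp)
  ultimately have "append_cols X (hcat r Xs)
      \<in> carrier_mat r (dim_col X + sum_list (map dim_col Xs))"
    by (rule append_cols_carrier)
  then show ?case by (simp add: hcat_def)
qed (simp add: hcat_def)

lemma vcat_carrier:
  assumes "\<forall>X \<in> set Xs. dim_col X = c"
  shows "vcat c Xs \<in> carrier_mat (sum_list (map dim_row Xs)) c"
  using assms
proof (induction Xs)
  case (Cons X Xs)
  have "X \<in> carrier_mat (dim_row X) c" using Cons.prems by auto
  moreover have "vcat c Xs \<in> carrier_mat (sum_list (map dim_row Xs)) c"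
    by (rule Cons.IH) (use Cons.prems in simp)
  ultimately have "append_rows X (vcat c Xs)
      \<in> carrier_mat (dim_row X + sum_list (map dim_row Xs)) c"
    by (rule carrier_append_rows)
  then show ?case by (simp add: vcat_def)
qed (simp add: vcat_def)

lemma sum_list_take_bound:
  fixes xs :: "nat list"
  assumes "q < length xs" "b < xs ! q"
  shows "sum_list (take q xs) + b < sum_list xs"
proof -
  have "sum_list xs = sum_list (take q xs) + (xs ! q + sum_list (drop (Suc q) xs))"
    by (metis append_take_drop_id assms(1) Cons_nth_drop_Suc sum_list.Cons sum_list_append)
  with assms show ?thesis by simp
qed

lemma hcat_index:
  assumes "\<forall>X \<in> set Xs. dim_row X = r" "i < r" "q < length Xs" "b < dim_col (Xs ! q)"
  shows "hcat r Xs $$ (i, sum_list (take q (map dim_col Xs)) + b) = (Xs ! q) $$ (i, b)"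
  using assms
proof (induction Xs arbitrary: q)
  case (Cons X Xs)
  have X: "X \<in> carrier_mat r (dim_col X)" using Cons.prems by auto
  have H: "hcat r Xs \<in> carrier_mat r (sum_list (map dim_col Xs))"
    using Cons.prems by (intro hcat_carrier) auto
  have eq: "hcat r (X # Xs) = append_cols X (hcat r Xs)" by (simp add: hcat_def)
  have "sum_list (take q (map dim_col (X # Xs))) + b < sum_list (map dim_col (X # Xs))"
    using Cons.prems by (intro sum_list_take_bound) (auto simp del: list.map)
  then have bd: "sum_list (take q (map dim_col (X # Xs))) + b
      < dim_col X + sum_list (map dim_col Xs)" by simp
  show ?case
    unfolding eq append_cols_index[OF X H Cons.prems(2) bd]
    using Cons.prems Cons.IH by (cases q) auto
qed simp

lemma vcat_index:
  assumes "\<forall>X \<in> set Xs. dim_col X = c" "j < c" "p < length Xs" "a < dim_row (Xs ! p)"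
  shows "vcat c Xs $$ (sum_list (take p (map dim_row Xs)) + a, j) = (Xs ! p) $$ (a, j)"
  using assms
proof (induction Xs arbitrary: p)
  case (Cons X Xs)
  have X: "X \<in> carrier_mat (dim_row X) c" using Cons.prems by auto
  have H: "vcat c Xs \<in> carrier_mat (sum_list (map dim_row Xs)) c"
    using Cons.prems by (intro vcat_carrier) auto
  have eq: "vcat c (X # Xs) = append_rows X (vcat c Xs)" by (simp add: vcat_def)
  have "sum_list (take p (map dim_row (X # Xs))) + a < sum_list (map dim_row (X # Xs))"
    using Cons.prems by (intro sum_list_take_bound) (auto simp del: list.map)
  then have bd: "sum_list (take p (map dim_row (X # Xs))) + a
      < dim_row X + sum_list (map dim_row Xs)" by simp
  show ?case
    unfolding eq append_rows_index[OF X H bd Cons.prems(2)]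
    using Cons.prems Cons.IH by (cases p) auto
qed simp

lemma sum_list_take_upt:
  fixes s :: "nat \<Rightarrow> nat"
  assumes "q \<le> k"
  shows "sum_list (take q (map s [0..<k])) = (\<Sum>i<q. s i)"
  using assms by (simp add: take_map interv_sum_list_conv_sum_set_nat atLeast0LessThan)

lemma sum_list_upt:
  fixes s :: "nat \<Rightarrow> nat"
  shows "sum_list (map s [0..<k]) = (\<Sum>i<k. s i)"
  by (simp add: interv_sum_list_conv_sum_set_nat atLeast0LessThan)

lemma block_row_carrier:
  assumes "\<And>q. q < k \<Longrightarrow> R q \<in> carrier_mat r (s q)"
  shows "hcat r (map R [0..<k]) \<in> carrier_mat r (\<Sum>q<k. s q)"
proof -
  have "map dim_col (map R [0..<k]) = map s [0..<k]"
    by (simp, intro ballI carrier_matD(2)[OF assms]) simp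
  moreover have "\<forall>X \<in> set (map R [0..<k]). dim_row X = r"
    by (simp, intro ballI carrier_matD(1)[OF assms]) simp
  ultimately show ?thesis
    using hcat_carrier[of "map R [0..<k]" r] sum_list_upt[of s k] by metis
qed

lemma block_mat_carrier:
  assumes "\<And>p q. p < k \<Longrightarrow> q < k \<Longrightarrow> F p q \<in> carrier_mat (s p) (s q)"
  shows "block_mat k s F \<in> carrier_mat (\<Sum>p<k. s p) (\<Sum>p<k. s p)"
proof -
  let ?R = "\<lambda>p. hcat (s p) (map (F p) [0..<k])"
  have R: "?R p \<in> carrier_mat (s p) (\<Sum>p<k. s p)" if "p < k" for p
    using block_row_carrier[of k "F p" "s p" s] assms[OF that] by blast
  have rows: "map dim_row (map ?R [0..<k]) = map s [0..<k]"
    by (simp, intro ballI carrier_matD(1)[OF R]) simp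
  have "\<forall>X \<in> set (map ?R [0..<k]). dim_col X = (\<Sum>p<k. s p)"
    by (simp, intro ballI carrier_matD(2)[OF R]) simp
  from vcat_carrier[OF this] show ?thesis
    unfolding block_mat_def rows sum_list_upt .
qed

lemma block_mat_index:
  assumes F: "\<And>p q. p < k \<Longrightarrow> q < k \<Longrightarrow> F p q \<in> carrier_mat (s p) (s q)"
    and p: "p < k" and q: "q < k" and a: "a < s p" and b: "b < s q"
  shows "block_mat k s F $$ ((\<Sum>i<p. s i) + a, (\<Sum>i<q. s i) + b) = F p q $$ (a, b)"
proof -
  let ?R = "\<lambda>p. hcat (s p) (map (F p) [0..<k])"
  have R: "?R p \<in> carrier_mat (s p) (\<Sum>p<k. s p)" if "p < k" for p
    using block_row_carrier[of k "F p" "s p" s] F[OF that] by blast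
  have rows: "map dim_row (map ?R [0..<k]) = map s [0..<k]"
    by (simp, intro ballI carrier_matD(1)[OF R]) simp
  have rows': "\<forall>X \<in> set (map ?R [0..<k]). dim_col X = (\<Sum>p<k. s p)"
    by (simp, intro ballI carrier_matD(2)[OF R]) simp
  have cols: "map dim_col (map (F p) [0..<k]) = map s [0..<k]"
    by (simp, intro ballI carrier_matD(2)[OF F[OF p]]) simp
  have cols': "\<forall>X \<in> set (map (F p) [0..<k]). dim_row X = s p"
    by (simp, intro ballI carrier_matD(1)[OF F[OF p]]) simp
  have j: "(\<Sum>i<q. s i) + b < (\<Sum>p<k. s p)"
    using sum_list_take_bound[of q "map s [0..<k]" b] q b
    by (simp add: sum_list_take_upt sum_list_upt)
  have "a < dim_row (map ?R [0..<k] ! p)"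
    using carrier_matD(1)[OF R[OF p]] p a by simp
  from vcat_index[OF rows' j _ this]
  have "block_mat k s F $$ ((\<Sum>i<p. s i) + a, (\<Sum>i<q. s i) + b)
      = ?R p $$ (a, (\<Sum>i<q. s i) + b)"
    unfolding block_mat_def rows using p by (simp add: sum_list_take_upt)
  also have "b < dim_col (map (F p) [0..<k] ! q)"
    using carrier_matD(2)[OF F[OF p q]] q b by simp
  from hcat_index[OF cols' a _ this]
  have "?R p $$ (a, (\<Sum>i<q. s i) + b) = F p q $$ (a, b)"
    unfolding cols using q by (simp add: sum_list_take_upt)
  finally show ?thesis .
qed

end

theory Submission imports Defs begin

text \<open>
  A positive semidefinite \<open>M\<close> with \<open>x\<^sup>\<dagger> M x = 0\<close> has \<open>M x = 0\<close>. Applied to \<open>x = (v, 0, \<dots>, 0)\<close> with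
  \<open>A v = 0\<close>, the block rows of \<open>M x = 0\<close> give \<open>B\<^sub>\<alpha>\<^sup>\<dagger> v = 0\<close>. Since \<open>A\<close> is Hermitian, every vector
  orthogonal to \<open>Ran A\<close> lies in its kernel, hence is orthogonal to \<open>Ran B\<^sub>\<alpha>\<close>, and the double
  annihilator of a finite set being its span, \<open>Ran B\<^sub>\<alpha> \<subseteq> Ran A\<close>. For the minors, a matrix with trivial kernel has rows spanning the whole
  space, so a basis chosen among the rows gives a nonvanishing maximal minor.
\<close>

section \<open>Independent subsets and annihilators\<close>

context vec_space begin

text \<open>Supplies the maximal independent set of columns from which
  \<open>rank_card_indpt\<close> reads off the rank. The extension starts at the empty set, whose
  independence is inherited from a basis.\<close>

lemma maximal_lin_indpt_subset_exists:
  assumes "finite X"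
  obtains S where "maximal S (\<lambda>T. T \<subseteq> X \<and> lin_indpt T)"
proof -
  obtain b where "basis b" using finite_basis_exists fin_dim by blast
  then have "lin_indpt {}" unfolding basis_def using subset_li_is_li[of b "{}"] by blast
  then show thesis
    using maximal_exists_superset[of X "\<lambda>T. T \<subseteq> X \<and> lin_indpt T" "{}"] assms that by blast
qed

text \<open>Induction on \<open>S\<close>: if some \<open>w\<close> annihilates \<open>S\<close> but not the new element \<open>s\<close>, subtracting
  the multiple of \<open>s\<close> that makes \<open>w\<close> annihilate \<open>b\<close> reduces the claim to \<open>S\<close>.\<close>

lemma span_if_annihilated:
  assumes "finite S" "S \<subseteq> carrier_vec n" "b \<in> carrier_vec n"
    and "\<And>u. u \<in> orthogonal_complement S \<Longrightarrow> u \<bullet> b = 0"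
  shows "b \<in> span S"
  using assms
proof (induction S arbitrary: b rule: finite_induct)
  case empty
  have "b = 0\<^sub>v n"
  proof (rule eq_vecI)
    fix i assume i: "i < dim_vec (0\<^sub>v n)"
    then have "unit_vec n i \<bullet> b = 0"
      using empty(3)[of "unit_vec n i"] by (simp add: orthogonal_complement_def)
    then show "b $ i = 0\<^sub>v n $ i" using i empty(2) by simp
  qed (use empty(2) in simp)
  then show ?case by (simp add: span_empty)
next
  case (insert s S)
  then have s: "s \<in> carrier_vec n" and S: "S \<subseteq> carrier_vec n" and b: "b \<in> carrier_vec n" by auto
  have mono: "span S \<subseteq> span (insert s S)" by (intro span_is_monotone) auto
  show ?case
  proof (cases "\<forall>u \<in> orthogonal_complement S. u \<bullet> s = 0")
    case True
    then have "orthogonal_complement S \<subseteq> orthogonal_complement (insert s S)"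
      by (auto simp: orthogonal_complement_def)
    then have "b \<in> span S" using insert.IH[OF S b] insert.prems(3) by blast
    then show ?thesis using mono by blast
  next
    case False
    then obtain w where w: "w \<in> carrier_vec n" "\<And>y. y \<in> S \<Longrightarrow> w \<bullet> y = 0" and ws: "w \<bullet> s \<noteq> 0"
      by (auto simp: orthogonal_complement_def)
    define c where "c = (w \<bullet> b) / (w \<bullet> s)"
    have "b - c \<cdot>\<^sub>v s \<in> span S"
    proof (rule insert.IH[OF S])
      show "b - c \<cdot>\<^sub>v s \<in> carrier_vec n" using b s by simp
      fix u assume "u \<in> orthogonal_complement S"
      then have u: "u \<in> carrier_vec n" "\<And>y. y \<in> S \<Longrightarrow> u \<bullet> y = 0"
        by (auto simp: orthogonal_complement_def)
      \<comment> \<open>With this coefficient \<open>u - ?t \<cdot>\<^sub>v w\<close> annihilates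
        \<open>s\<close> as well as \<open>S\<close>, so the hypothesis on \<open>b\<close> applies
        to it. The pairing is bilinear, without conjugation.\<close>
      let ?t = "(u \<bullet> s) / (w \<bullet> s)"
      have dist: "(u - ?t \<cdot>\<^sub>v w) \<bullet> y = u \<bullet> y - ?t * (w \<bullet> y)" if "y \<in> carrier_vec n" for y
        using that u w by (simp add: minus_scalar_prod_distrib[of _ n])
      have "u - ?t \<cdot>\<^sub>v w \<in> orthogonal_complement (insert s S)"
        using u w ws s S dist by (auto simp: orthogonal_complement_def)
      from insert.prems(3)[OF this] have "u \<bullet> b = c * (u \<bullet> s)"
        using dist[OF b] by (simp add: c_def)
      then show "u \<bullet> (b - c \<cdot>\<^sub>v s) = 0"
        using u b s by (simp add: scalar_prod_minus_distrib[of _ n])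
    qed
    then have "b - c \<cdot>\<^sub>v s \<in> span (insert s S)" using mono by blast
    moreover have "c \<cdot>\<^sub>v s \<in> span (insert s S)"
      using S s by (intro smult_in_span span_mem) auto
    ultimately have "(b - c \<cdot>\<^sub>v s) + c \<cdot>\<^sub>v s \<in> span (insert s S)"
      using S s by (intro span_add1) auto
    moreover have "(b - c \<cdot>\<^sub>v s) + c \<cdot>\<^sub>v s = b" using b s by (intro eq_vecI) auto
    ultimately show ?thesis by simp
  qed
qed

end

section \<open>Submatrices formed by selected columns\<close>

lemma transpose_submatrix: "(submatrix M I J)\<^sup>T = submatrix M\<^sup>T J I"
  by (rule eq_matI) (auto simp: dim_submatrix submatrix_index pick_le)

text \<open>\<open>pick J\<close> lists \<open>J\<close> in increasing order, so it is injective;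
  counting elements then gives surjectivity.\<close>

lemma bij_betw_pick:
  assumes "finite J"
  shows "bij_betw (pick J) {..<card J} J"
proof -
  have "inj_on (pick J) {..<card J}"
    by (rule inj_onI) (metis lessThan_iff nat_neq_iff pick_mono_le)
  moreover have "pick J ` {..<card J} \<subseteq> J" by (auto intro: pick_in_set_le)
  ultimately show ?thesis
    using assms by (metis bij_betw_def card_image card_lessThan card_subset_eq)
qed

lemma set_cols: "set (cols M) = col M ` {..<dim_col M}"
  by (auto simp: cols_def)

lemma cols_submatrix_UNIV:
  assumes "J \<subseteq> {..<dim_col M}"
  shows "cols (submatrix M UNIV J) = map (col M \<circ> pick J) [0..<card J]"
proof -
  have J: "{j. j < dim_col M \<and> j \<in> J} = J" using assms by auto
  have "col (submatrix M UNIV J) j = col M (pick J j)" if "j < card J" for j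
  proof (rule eq_vecI)
    show "dim_vec (col (submatrix M UNIV J) j) = dim_vec (col M (pick J j))"
      by (simp add: dim_submatrix)
    have "pick J j < dim_col M" using pick_in_set_le[OF that] assms by auto
    then show "col (submatrix M UNIV J) j $ i = col M (pick J j) $ i"
      if "i < dim_vec (col M (pick J j))" for i
      using that \<open>j < card J\<close> by (simp add: dim_submatrix J submatrix_index pick_UNIV)
  qed
  then show ?thesis by (simp add: cols_def dim_submatrix J)
qed

text \<open>Equal columns of \<open>M\<close> collapse in \<open>set (cols M)\<close>. Choosing one
  index for each member of \<open>T\<close> yields a submatrix whose columns run through
  \<open>T\<close> without repetition, so independence of the set \<open>T\<close> becomes
  independence of a list of columns.\<close>

lemma subset_cols_eq_cols_submatrix:
  assumes "T \<subseteq> set (cols M)"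
  obtains J where "J \<subseteq> {..<dim_col M}" "card J = card T"
    "distinct (cols (submatrix M UNIV J))" "set (cols (submatrix M UNIV J)) = T"
proof -
  obtain J where J: "J \<subseteq> {..<dim_col M}" "inj_on (col M) J" "T = col M ` J"
    using assms[unfolded set_cols] subset_image_inj by metis
  have "bij_betw (pick J) {..<card J} J"
    using J(1) by (intro bij_betw_pick) (rule finite_subset, auto)
  then have "bij_betw (col M \<circ> pick J) {..<card J} T"
    by (rule bij_betw_trans) (use J(2,3) in \<open>simp add: bij_betw_def\<close>)
  then have "distinct (cols (submatrix M UNIV J))" "set (cols (submatrix M UNIV J)) = T"
    by (simp_all add: cols_submatrix_UNIV[OF J(1)] distinct_map atLeast0LessThan bij_betw_def)
  then show thesis using that[OF J(1)] J(2,3) by (simp add: card_image)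
qed

section \<open>Rank and vanishing minors\<close>

lemma trivial_kernel_nonzero_minor:
  fixes M :: "'a :: field mat"
  assumes M: "M \<in> carrier_mat nr k"
    and ker: "\<And>v. v \<in> carrier_vec k \<Longrightarrow> M *\<^sub>v v = 0\<^sub>v nr \<Longrightarrow> v = 0\<^sub>v k"
  obtains I where "I \<subseteq> {..<nr}" "card I = k" "det (submatrix M I UNIV) \<noteq> 0"
proof -
  interpret vec_space "TYPE('a)" k .
  \<comment> \<open>Rows of \<open>M\<close> are treated as columns of its transpose, since rank and
    column selection are phrased for columns.\<close>
  let ?R = "set (cols M\<^sup>T)"
  have Mt: "M\<^sup>T \<in> carrier_mat k nr" using M by simp
  then have R: "?R \<subseteq> carrier_vec k" using cols_dim by blast
  have "span ?R = carrier_vec k"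
  proof
    show "carrier_vec k \<subseteq> span ?R"
    proof
      fix b :: "'a vec" assume b: "b \<in> carrier_vec k"
      show "b \<in> span ?R"
      proof (rule span_if_annihilated[OF _ R b])
        fix u assume "u \<in> orthogonal_complement ?R"
        then have u: "u \<in> carrier_vec k" and "\<And>y. y \<in> ?R \<Longrightarrow> u \<bullet> y = 0"
          by (auto simp: orthogonal_complement_def)
        then have "row M i \<bullet> u = 0" if "i < nr" for i
          using that M comm_scalar_prod[of u k "row M i"] by (auto simp: rows_def)
        \<comment> \<open>A vector annihilating every row of \<open>M\<close> lies in its kernel,
          hence is zero.\<close>
        then have "M *\<^sub>v u = 0\<^sub>v nr" using M by (intro eq_vecI) auto
        then show "u \<bullet> b = 0" using ker[OF u] b by simp
      qed simp
    qed
  qed (use R span_closed in auto)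
  \<comment> \<open>The rank is the dimension of the span viewed as a space of its own; here that
    space is all of \<open>V\<close>.\<close>
  moreover have "vs (carrier_vec k) = V" by (simp add: module_vec_def)
  ultimately have rank: "rank M\<^sup>T = k" unfolding rank_def by (metis dim_is_n)
  obtain S where S: "maximal S (\<lambda>T. T \<subseteq> ?R \<and> lin_indpt T)"
    by (rule maximal_lin_indpt_subset_exists[OF finite_set])
  then have Sk: "card S = k" "S \<subseteq> ?R" "lin_indpt S"
    using rank_card_indpt[OF Mt S] rank by (auto simp: maximal_def)
  then obtain I where I: "I \<subseteq> {..<nr}" "card I = k"
    and N: "distinct (cols (submatrix M\<^sup>T UNIV I))" "set (cols (submatrix M\<^sup>T UNIV I)) = S"
    using subset_cols_eq_cols_submatrix[of S "M\<^sup>T"] M by auto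
  have "{i. i < nr \<and> i \<in> I} = I" using I(1) by auto
  then have C: "submatrix M\<^sup>T UNIV I \<in> carrier_mat k k"
    using carrier_matD[OF M] I(2) by (intro carrier_matI) (simp_all add: dim_submatrix)
  have "rank (submatrix M\<^sup>T UNIV I) = k"
    by (rule lin_indpt_full_rank[OF C N(1)]) (unfold N(2), rule Sk(3))
  then have "det (submatrix M\<^sup>T UNIV I) \<noteq> 0"
    by (rule det_rank_iff[OF C, THEN iffD2])
  then have "det (submatrix M I UNIV) \<noteq> 0"
    using det_transpose[OF C] by (simp add: transpose_submatrix)
  with I show thesis by (rule that)
qed

context vec_space begin

text \<open>A nonzero minor of size \<open>k + 1\<close> comes from \<open>k + 1\<close> independent
  columns. Conversely, if the rank exceeds \<open>k\<close>, then \<open>k + 1\<close> independent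
  columns form a matrix with trivial kernel, and suitable rows of it give a nonzero minor.\<close>

lemma rank_le_iff_minors:
  assumes M: "M \<in> carrier_mat n nc"
  shows "rank M \<le> k \<longleftrightarrow> (\<forall>\<mu> \<in> minors (k + 1) M. \<mu> = 0)"
proof
  assume r: "rank M \<le> k"
  show "\<forall>\<mu> \<in> minors (k + 1) M. \<mu> = 0"
  proof (rule ballI, rule ccontr)
    fix \<mu> assume "\<mu> \<in> minors (k + 1) M" and "\<mu> \<noteq> 0"
    then obtain I J where "det (submatrix M I J) \<noteq> 0" "J \<subseteq> {..<nc}" "card J = k + 1"
      using M by (auto simp: minors_def)
    moreover from this have "{j. j < nc \<and> j \<in> J} = J" by auto
    ultimately show False using rank_gt_minor[OF M, of I J] r by simp
  qed
next
  assume minors: "\<forall>\<mu> \<in> minors (k + 1) M. \<mu> = 0"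
  show "rank M \<le> k"
  proof (rule ccontr)
    assume "\<not> rank M \<le> k"
    then have r: "k + 1 \<le> rank M" by simp
    obtain S where S: "maximal S (\<lambda>T. T \<subseteq> set (cols M) \<and> lin_indpt T)"
      by (rule maximal_lin_indpt_subset_exists[OF finite_set])
    then have "k + 1 \<le> card S" "S \<subseteq> set (cols M)" "lin_indpt S"
      using rank_card_indpt[OF M S] r by (auto simp: maximal_def)
    then obtain T where T: "card T = k + 1" "T \<subseteq> set (cols M)" "lin_indpt T"
      by (metis obtain_subset_with_card_n order_trans subset_li_is_li)
    from T(2) obtain J where J: "J \<subseteq> {..<nc}" "card J = k + 1"
      and N: "distinct (cols (submatrix M UNIV J))" "set (cols (submatrix M UNIV J)) = T"
      using subset_cols_eq_cols_submatrix[of T M] M T(1) by auto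
    have "{j. j < nc \<and> j \<in> J} = J" using J(1) by auto
    then have C: "submatrix M UNIV J \<in> carrier_mat n (k + 1)"
      using carrier_matD[OF M] J(2) by (intro carrier_matI) (simp_all add: dim_submatrix)
    obtain I where "I \<subseteq> {..<n}" "card I = k + 1" "det (submatrix (submatrix M UNIV J) I UNIV) \<noteq> 0"
    proof (rule trivial_kernel_nonzero_minor[OF C])
      fix v assume v: "v \<in> carrier_vec (k + 1)" "submatrix M UNIV J *\<^sub>v v = 0\<^sub>v n"
      show "v = 0\<^sub>v (k + 1)"
      proof (rule ccontr)
        assume "v \<noteq> 0\<^sub>v (k + 1)"
        \<comment> \<open>A nonzero kernel vector is a dependence among the columns. Because they
          are distinct, it is also a dependence of the set \<open>T\<close>.\<close>
        from lin_depI[OF C v(1) this v(2) N(1)] T(3) show False unfolding N(2) by contradiction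
      qed
    qed
    moreover from this have "det (submatrix M I J) \<in> minors (k + 1) M"
      unfolding minors_def using J M by blast
    ultimately show False using minors submatrix_split[of M I J] by auto
  qed
qed

section \<open>Range inclusion as a rank condition\<close>

lemma cols_append_cols:
  assumes A: "A \<in> carrier_mat n a" and X: "X \<in> carrier_mat n b"
  shows "set (cols (append_cols A X)) = set (cols A) \<union> set (cols X)"
proof -
  let ?M = "append_cols A X"
  note dims = carrier_matD[OF A] carrier_matD[OF X] carrier_matD[OF append_cols_carrier[OF A X]]
  have colA: "col ?M j = col A j" if "j < a" for j
    using that by (intro eq_vecI) (simp_all add: dims append_cols_index[OF A X])
  have colX: "col ?M (a + j) = col X j" if "j < b" for j
    using that by (intro eq_vecI) (simp_all add: dims append_cols_index[OF A X])
  have "col ?M ` {..<a + b} = col A ` {..<a} \<union> col X ` {..<b}"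
  proof (intro equalityI subsetI)
    fix y assume "y \<in> col ?M ` {..<a + b}"
    then obtain j where j: "j < a + b" "y = col ?M j" by auto
    show "y \<in> col A ` {..<a} \<union> col X ` {..<b}"
    proof (cases "j < a")
      case True
      then show ?thesis using j colA by auto
    next
      case False
      then show ?thesis using j colX[of "j - a"] by auto
    qed
  next
    fix y assume "y \<in> col A ` {..<a} \<union> col X ` {..<b}"
    then show "y \<in> col ?M ` {..<a + b}"
    proof
      assume "y \<in> col X ` {..<b}"
      then obtain j where "j < b" "y = col X j" by auto
      then show ?thesis using colX[of j] by (intro image_eqI[of _ _ "a + j"]) auto
    qed (auto simp flip: colA)
  qed
  then show ?thesis by (simp add: set_cols dims)
qed

text \<open>If the columns of \<open>X\<close> lie in the range of \<open>A\<close>, appending them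
  leaves the span unchanged. Otherwise a column of \<open>X\<close> outside that range enlarges a
  maximal independent set of columns of \<open>A\<close>, so the rank grows.\<close>

lemma col_space_subset_iff_rank_append_cols:
  assumes A: "A \<in> carrier_mat n a" and X: "X \<in> carrier_mat n b"
  shows "col_space X \<subseteq> col_space A \<longleftrightarrow> rank (append_cols A X) \<le> rank A"
proof
  have cA: "set (cols A) \<subseteq> carrier_vec n" and cX: "set (cols X) \<subseteq> carrier_vec n"
    using A X cols_dim by blast+
  {
    assume "col_space X \<subseteq> col_space A"
    then have "set (cols A) \<union> set (cols X) \<subseteq> span (set (cols A))"
      using in_own_span[OF cA] in_own_span[OF cX] by (auto simp: col_space_def)
    then have "span (set (cols A) \<union> set (cols X)) \<subseteq> span (set (cols A))"
      by (rule span_subsetI[OF cA])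
    then have "span (set (cols A) \<union> set (cols X)) = span (set (cols A))"
      using span_is_monotone[OF Un_upper1] by (rule equalityI)
    then show "rank (append_cols A X) \<le> rank A" by (simp add: rank_def cols_append_cols[OF A X])
  next
    assume r: "rank (append_cols A X) \<le> rank A"
    obtain S where S: "maximal S (\<lambda>T. T \<subseteq> set (cols A) \<and> lin_indpt T)"
      by (rule maximal_lin_indpt_subset_exists[OF finite_set])
    then have SA: "S \<subseteq> set (cols A)" and ind: "lin_indpt S" by (auto simp: maximal_def)
    then have Sc: "S \<subseteq> carrier_vec n" using cA by blast
    have "x \<in> span (set (cols A))" if "x \<in> set (cols X)" for x
    proof (rule ccontr)
      assume "x \<notin> span (set (cols A))"
      then have x: "x \<notin> span S" using span_is_monotone[OF SA] by blast
      then have "x \<notin> S" using in_own_span[OF Sc] by blast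
      have "lin_indpt (S \<union> {x})"
        using lin_dep_iff_in_span[OF Sc ind _ \<open>x \<notin> S\<close>] x that cX by blast
      moreover have "S \<union> {x} \<subseteq> set (cols (append_cols A X))"
        using SA that by (auto simp: cols_append_cols[OF A X])
      ultimately have "card (S \<union> {x}) \<le> rank (append_cols A X)"
        using rank_ge_card_indpt[OF append_cols_carrier[OF A X]] by blast
      then show False
        using r \<open>x \<notin> S\<close> rank_card_indpt[OF A S] finite_subset[OF SA] by simp
    qed
    then show "col_space X \<subseteq> col_space A"
      unfolding col_space_def by (intro span_subsetI[OF cA] subsetI)
  }
qed

end

section \<open>Adjoints and positive semidefinite forms\<close>

lemma mat_adjoint_dim [simp]: "dim_row (mat_adjoint M) = dim_col M" "dim_col (mat_adjoint M) = dim_row M"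
  by (auto simp: mat_adjoint_def)

lemma mat_adjoint_carrier [simp]: "M \<in> carrier_mat nr nc \<Longrightarrow> mat_adjoint M \<in> carrier_mat nc nr"
  by (intro carrier_matI) auto

lemma mat_adjoint_index:
  "i < dim_col M \<Longrightarrow> j < dim_row M \<Longrightarrow> mat_adjoint M $$ (i, j) = conjugate (M $$ (j, i))"
  by (simp add: mat_adjoint_def mat_of_rows_index)

lemma hermitian_cscalar_prod:
  fixes M :: "complex mat"
  assumes M: "M \<in> carrier_mat n n" "mat_adjoint M = M"
    and v: "v \<in> carrier_vec n" and w: "w \<in> carrier_vec n"
  shows "(M *\<^sub>v v) \<bullet>c w = v \<bullet>c (M *\<^sub>v w)"
proof -
  have sym: "M $$ (i, j) = cnj (M $$ (j, i))" if "i < n" "j < n" for i j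
    using mat_adjoint_index[of i M j] M that by simp
  have "(M *\<^sub>v v) \<bullet>c w = (\<Sum>i<n. \<Sum>j<n. M $$ (i, j) * v $ j * cnj (w $ i))"
    using M v w by (simp add: scalar_prod_def lessThan_atLeast0 sum_distrib_right)
  also have "\<dots> = (\<Sum>j<n. \<Sum>i<n. M $$ (i, j) * v $ j * cnj (w $ i))" by (rule sum.swap)
  also have "\<dots> = (\<Sum>j<n. \<Sum>i<n. v $ j * cnj (M $$ (j, i) * w $ i))"
    by (intro sum.cong refl) (simp add: sym[symmetric] ac_simps)
  also have "\<dots> = v \<bullet>c (M *\<^sub>v w)"
    using M v w by (simp add: scalar_prod_def lessThan_atLeast0 sum_distrib_left)
  finally show ?thesis .
qed

text \<open>With \<open>y = M *\<^sub>v x\<close>, the form at \<open>y + s x\<close> has real part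
  \<open>c + 2 * s * p\<close>, where \<open>p\<close> is the squared norm of \<open>y\<close>.
  Nonnegativity for every real \<open>s\<close>, negative ones included, forces
  \<open>p = 0\<close>.\<close>

lemma pos_semidef_kernel:
  assumes M: "M \<in> carrier_mat n n" "pos_semidef M"
    and x: "x \<in> carrier_vec n" and q: "(M *\<^sub>v x) \<bullet>c x = 0"
  shows "M *\<^sub>v x = 0\<^sub>v n"
proof -
  have herm: "mat_adjoint M = M" and psd: "\<And>v. v \<in> carrier_vec n \<Longrightarrow> 0 \<le> (M *\<^sub>v v) \<bullet>c v"
    using M by (auto simp: pos_semidef_def)
  define y where "y = M *\<^sub>v x"
  have y: "y \<in> carrier_vec n" and My: "M *\<^sub>v y \<in> carrier_vec n" using M x by (auto simp: y_def)
  define p where "p = Re (y \<bullet>c y)"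
  define c where "c = Re ((M *\<^sub>v y) \<bullet>c y)"
  have yy: "y \<bullet>c y = of_real p"
    using conjugate_square_ge_0_vec[of y] by (simp add: p_def less_eq_complex_def complex_eq_iff)
  \<comment> \<open>The form at \<open>y + s x\<close> is affine in \<open>s\<close> because its quadratic coefficient is \<open>x\<^sup>\<dagger> M x = 0\<close>.\<close>
  have *: "0 \<le> c + 2 * s * p" for s :: real
  proof -
    let ?s = "complex_of_real s"
    let ?z = "y + ?s \<cdot>\<^sub>v x"
    have "M *\<^sub>v ?z = M *\<^sub>v y + ?s \<cdot>\<^sub>v y"
      using M x y by (simp add: mult_add_distrib_mat_vec[of _ n n] mult_mat_vec[of _ n n] y_def)
    moreover have "conjugate ?z = conjugate y + ?s \<cdot>\<^sub>v conjugate x"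
      using x y by (simp add: conjugate_add_vec[of _ n] conjugate_smult_vec)
    ultimately have "(M *\<^sub>v ?z) \<bullet>c ?z = (M *\<^sub>v y) \<bullet>c y + ?s * ((M *\<^sub>v y) \<bullet>c x) + ?s * (y \<bullet>c y) + ?s * ?s * (y \<bullet>c x)"
      using x y My by (simp add: add_scalar_prod_distrib[of _ n] scalar_prod_add_distrib[of _ n] algebra_simps)
    \<comment> \<open>Self-adjointness makes both cross terms equal to the squared norm of
      \<open>y\<close>, whence the factor 2.\<close>
    also have "(M *\<^sub>v y) \<bullet>c x = y \<bullet>c y"
      using hermitian_cscalar_prod[OF M(1) herm y x] by (simp add: y_def)
    also have "y \<bullet>c x = 0" using q by (simp add: y_def)
    finally have "Re ((M *\<^sub>v ?z) \<bullet>c ?z) = c + 2 * s * p" by (simp add: yy c_def)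
    then show ?thesis using psd[of ?z] x y by (simp add: less_eq_complex_def)
  qed
  have "p = 0"
  proof (rule ccontr)
    assume "p \<noteq> 0"
    \<comment> \<open>At this value of \<open>s\<close> the affine expression equals -1.\<close>
    then show False using *[of "- (c + 1) / (2 * p)"] by (simp add: field_simps)
  qed
  then show ?thesis using yy y by (simp flip: y_def)
qed

section \<open>The bordered block matrix\<close>

text \<open>The first block column determines the product of \<open>G\<close> with a vector
  supported on the first \<open>d\<close> coordinates. The partial sum of \<open>s\<close> below
  \<alpha> is the row offset of block \<alpha>.\<close>

lemma bordered_mat_carrier_index:
  fixes n :: "nat \<Rightarrow> nat"
  assumes A: "A \<in> carrier_mat d d"
    and B: "\<And>\<alpha>. \<alpha> \<in> {1..m} \<Longrightarrow> B \<alpha> \<in> carrier_mat d (n \<alpha>)"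
    and C: "\<And>\<alpha> \<beta>. \<alpha> \<in> {1..m} \<Longrightarrow> \<beta> \<in> {1..m} \<Longrightarrow> C \<alpha> \<beta> \<in> carrier_mat (n \<alpha>) (n \<beta>)"
  defines "s \<equiv> \<lambda>p. if p = 0 then d else n p"
  defines "G \<equiv> bordered_mat d m n A B C"
  shows "G \<in> carrier_mat (\<Sum>p<Suc m. s p) (\<Sum>p<Suc m. s p)"
    and "\<And>i j. i < d \<Longrightarrow> j < d \<Longrightarrow> G $$ (i, j) = A $$ (i, j)"
    and "\<And>\<alpha> b j. \<alpha> \<in> {1..m} \<Longrightarrow> b < n \<alpha> \<Longrightarrow> j < d \<Longrightarrow>
      G $$ ((\<Sum>p<\<alpha>. s p) + b, j) = conjugate (B \<alpha> $$ (j, b))"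
proof -
  let ?F = "\<lambda>p q. if p = 0 \<and> q = 0 then A else if p = 0 then B q
              else if q = 0 then mat_adjoint (B p) else C p q"
  have G: "G = block_mat (Suc m) s ?F" by (simp add: G_def s_def bordered_mat_def)
  have F: "?F p q \<in> carrier_mat (s p) (s q)" if "p < Suc m" "q < Suc m" for p q
    using that A B[of p] B[of q] C[of p q] by (auto simp: s_def)
  show "G \<in> carrier_mat (\<Sum>p<Suc m. s p) (\<Sum>p<Suc m. s p)"
    unfolding G by (rule block_mat_carrier[OF F])
  show "G $$ (i, j) = A $$ (i, j)" if "i < d" "j < d" for i j
    using block_mat_index[of "Suc m" ?F s 0 0 i j, OF F] that unfolding G by (simp add: s_def)
  show "G $$ ((\<Sum>p<\<alpha>. s p) + b, j) = conjugate (B \<alpha> $$ (j, b))"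
    if "\<alpha> \<in> {1..m}" "b < n \<alpha>" "j < d" for \<alpha> b j
    using block_mat_index[of "Suc m" ?F s \<alpha> 0 b j, OF F] that B[of \<alpha>] unfolding G
    by (simp add: s_def mat_adjoint_index)
qed

lemma pos_semidef_bordered_kernel:
  fixes n :: "nat \<Rightarrow> nat"
  assumes A: "A \<in> carrier_mat d d"
    and B: "\<And>\<alpha>. \<alpha> \<in> {1..m} \<Longrightarrow> B \<alpha> \<in> carrier_mat d (n \<alpha>)"
    and C: "\<And>\<alpha> \<beta>. \<alpha> \<in> {1..m} \<Longrightarrow> \<beta> \<in> {1..m} \<Longrightarrow> C \<alpha> \<beta> \<in> carrier_mat (n \<alpha>) (n \<beta>)"
    and psd: "pos_semidef (bordered_mat d m n A B C)"
    and v: "v \<in> carrier_vec d" "A *\<^sub>v v = 0\<^sub>v d"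
    and \<alpha>: "\<alpha> \<in> {1..m}" and b: "b \<in> set (cols (B \<alpha>))"
  shows "v \<bullet>c b = 0"
proof -
  define s where "s = (\<lambda>p. if p = 0 then d else n p)"
  define N where "N = (\<Sum>p<Suc m. s p)"
  define G where "G = bordered_mat d m n A B C"
  note idx = bordered_mat_carrier_index[of A d m B n C]
  have G1: "G \<in> carrier_mat N N"
    unfolding G_def N_def s_def using A B C by (rule idx(1))
  have G2: "G $$ (i, j) = A $$ (i, j)" if "i < d" "j < d" for i j
    unfolding G_def using A B C that by (rule idx(2))
  have G3: "G $$ ((\<Sum>p<\<alpha>. s p) + k, j) = conjugate (B \<alpha> $$ (j, k))"
    if "k < n \<alpha>" "j < d" for k j
    unfolding G_def s_def using A B C \<alpha> that by (rule idx(3))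
  obtain k where k: "k < n \<alpha>" "b = col (B \<alpha>) k"
    using b B[OF \<alpha>] by (auto simp: cols_def)
  \<comment> \<open>The kernel vector of \<open>A\<close>, padded with zeros to the size of
    \<open>G\<close>.\<close>
  define x where "x = vec N (\<lambda>i. if i < d then v $ i else 0)"
  have "N = s 0 + (\<Sum>p<m. s (Suc p))" unfolding N_def by (rule sum.lessThan_Suc_shift)
  then have dN: "d \<le> N" by (simp add: s_def)
  have Gx: "(G *\<^sub>v x) $ i = (\<Sum>j<d. G $$ (i, j) * v $ j)" if "i < N" for i
  proof -
    have "(G *\<^sub>v x) $ i = (\<Sum>j<N. G $$ (i, j) * (if j < d then v $ j else 0))"
      using that G1 by (simp add: x_def scalar_prod_def lessThan_atLeast0)
    also have "\<dots> = (\<Sum>j<d. G $$ (i, j) * v $ j)"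
      using dN by (intro sum.mono_neutral_cong_right) auto
    finally show ?thesis .
  qed
  have "(G *\<^sub>v x) $ i = 0" if "i < d" for i
  proof -
    have "(G *\<^sub>v x) $ i = (\<Sum>j<d. A $$ (i, j) * v $ j)"
      using that dN by (auto simp: Gx G2 intro!: sum.cong)
    also have "\<dots> = (A *\<^sub>v v) $ i"
      using that A v(1) by (simp add: scalar_prod_def lessThan_atLeast0)
    finally show ?thesis using v(2) that by simp
  qed
  \<comment> \<open>The first \<open>d\<close> coordinates of \<open>G *\<^sub>v x\<close> are those
    of \<open>A *\<^sub>v v\<close>, which is zero, and \<open>x\<close> vanishes on the others. So
    every term of the form is zero.\<close>
  then have "(G *\<^sub>v x) $ i * conjugate x $ i = 0" if "i < N" for i
    using that by (cases "i < d") (simp_all add: x_def)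
  moreover have "dim_vec (conjugate x) = N" by (simp add: x_def)
  ultimately have "(G *\<^sub>v x) \<bullet>c x = 0"
    unfolding scalar_prod_def by (intro sum.neutral) simp
  then have "G *\<^sub>v x = 0\<^sub>v N"
    using pos_semidef_kernel[of G N x] G1 psd by (simp add: G_def x_def)
  moreover have i: "(\<Sum>p<\<alpha>. s p) + k < N"
  proof -
    have "(\<Sum>p<\<alpha>. s p) + k < (\<Sum>p<Suc \<alpha>. s p)" using k \<alpha> by (simp add: s_def)
    also have "\<dots> \<le> N" unfolding N_def using \<alpha> by (intro sum_mono2) auto
    finally show ?thesis .
  qed
  \<comment> \<open>Row \<open>k\<close> of block row \<alpha> is the conjugate of column
    \<open>k\<close> of \<open>B \<alpha>\<close>, so this coordinate of
    \<open>G *\<^sub>v x\<close> is the inner product of \<open>v\<close> with that column.\<close>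
  ultimately have "(\<Sum>j<d. conjugate (B \<alpha> $$ (j, k)) * v $ j) = 0"
    using Gx[OF i] G3[OF k(1)] by simp
  then show ?thesis
    using k B[OF \<alpha>] v(1) by (simp add: scalar_prod_def lessThan_atLeast0 ac_simps)
qed

text \<open>Annihilators are taken for the bilinear pairing, whereas the kernel statement uses the
  sesquilinear one. The two are matched by conjugation: if \<open>u\<close> annihilates the columns
  of the Hermitian \<open>A\<close>, then \<open>conjugate u\<close> lies in its kernel.\<close>

lemma pos_semidef_bordered_col_space:
  fixes n :: "nat \<Rightarrow> nat"
  assumes A: "A \<in> carrier_mat d d"
    and B: "\<And>\<alpha>. \<alpha> \<in> {1..m} \<Longrightarrow> B \<alpha> \<in> carrier_mat d (n \<alpha>)"
    and C: "\<And>\<alpha> \<beta>. \<alpha> \<in> {1..m} \<Longrightarrow> \<beta> \<in> {1..m} \<Longrightarrow> C \<alpha> \<beta> \<in> carrier_mat (n \<alpha>) (n \<beta>)"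
    and psd: "pos_semidef (bordered_mat d m n A B C)"
    and herm: "mat_adjoint A = A" and \<alpha>: "\<alpha> \<in> {1..m}"
  shows "vec_space.col_space d (B \<alpha>) \<subseteq> vec_space.col_space d A"
proof -
  interpret vec_space "TYPE(complex)" d .
  have cA: "set (cols A) \<subseteq> carrier_vec d" and cB: "set (cols (B \<alpha>)) \<subseteq> carrier_vec d"
    using A B[OF \<alpha>] cols_dim by blast+
  have "b \<in> span (set (cols A))" if b: "b \<in> set (cols (B \<alpha>))" for b
  proof (rule span_if_annihilated[OF _ cA])
    show bc: "b \<in> carrier_vec d" using b cB by blast
    fix u assume "u \<in> orthogonal_complement (set (cols A))"
    then have u: "u \<in> carrier_vec d" and "\<And>y. y \<in> set (cols A) \<Longrightarrow> u \<bullet> y = 0"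
      by (auto simp: orthogonal_complement_def)
    then have col: "u \<bullet> col A i = 0" if "i < d" for i
      using that A by (auto simp: cols_def)
    have "A *\<^sub>v conjugate u = 0\<^sub>v d"
    proof (rule eq_vecI)
      fix i assume "i < dim_vec (0\<^sub>v d :: complex vec)"
      then have i: "i < d" by simp
      have "row A i = conjugate (col A i)"
        using mat_adjoint_index[of i A] herm A i by (intro eq_vecI) auto
      then have "(A *\<^sub>v conjugate u) $ i = conjugate (col A i \<bullet> u)"
        using i A u conjugate_sprod_vec[of "col A i" d u] by simp
      then show "(A *\<^sub>v conjugate u) $ i = 0\<^sub>v d $ i"
        using i A u col[OF i] comm_scalar_prod[of u d "col A i"] by simp
    qed (use A in simp)
    then have "conjugate u \<bullet>c b = 0"
      using pos_semidef_bordered_kernel[of A d m B n C, OF A B C psd] u \<alpha> b by simp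
    then show "u \<bullet> b = 0"
      using conjugate_sprod_vec[OF u bc] by simp
  qed simp
  then show ?thesis unfolding col_space_def by (intro span_subsetI[OF cA] subsetI)
qed

text \<open>For the blocks \<open>B \<alpha>\<close> all three conditions hold, so an equivalence
  between them would carry no content there. It is therefore stated for an arbitrary
  \<open>X\<close> with \<open>d\<close> rows.\<close>

theorem theorem6:
  fixes d r m :: nat and n :: "nat \<Rightarrow> nat"
    and A :: "complex mat" and B :: "nat \<Rightarrow> complex mat"
    and C :: "nat \<Rightarrow> nat \<Rightarrow> complex mat"
  assumes A: "A \<in> carrier_mat d d"
    and B: "\<And>\<alpha>. \<alpha> \<in> {1..m} \<Longrightarrow> B \<alpha> \<in> carrier_mat d (n \<alpha>)"
    and C: "\<And>\<alpha> \<beta>. \<alpha> \<in> {1..m} \<Longrightarrow> \<beta> \<in> {1..m} \<Longrightarrow> C \<alpha> \<beta> \<in> carrier_mat (n \<alpha>) (n \<beta>)"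
    and G_psd: "pos_semidef (bordered_mat d m n A B C)"
    and A_psd: "pos_semidef A"
    and rank_A: "vec_space.rank d A = r"
    and r_less: "r < d"
  shows "(\<forall>\<alpha> \<in> {1..m}. vec_space.col_space d (B \<alpha>) \<subseteq> vec_space.col_space d A)
    \<and> (\<forall>\<alpha> \<in> {1..m}. vec_space.rank d (append_cols A (B \<alpha>)) \<le> r)
    \<and> (\<forall>\<alpha> \<in> {1..m}. \<forall>\<mu> \<in> minors (r + 1) (append_cols A (B \<alpha>)). \<mu> = 0)
    \<and> (\<forall>k. \<forall>X \<in> carrier_mat d k.
          (vec_space.col_space d X \<subseteq> vec_space.col_space d A
             \<longleftrightarrow> vec_space.rank d (append_cols A X) \<le> r)
        \<and> (vec_space.rank d (append_cols A X) \<le> r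
             \<longleftrightarrow> (\<forall>\<mu> \<in> minors (r + 1) (append_cols A X). \<mu> = 0)))"
proof -
  have col: "vec_space.col_space d X \<subseteq> vec_space.col_space d A
      \<longleftrightarrow> vec_space.rank d (append_cols A X) \<le> r" if "X \<in> carrier_mat d k" for X k
    using vec_space.col_space_subset_iff_rank_append_cols[OF A that] rank_A by simp
  have minors: "vec_space.rank d (append_cols A X) \<le> r
      \<longleftrightarrow> (\<forall>\<mu> \<in> minors (r + 1) (append_cols A X). \<mu> = 0)" if "X \<in> carrier_mat d k" for X k
    by (rule vec_space.rank_le_iff_minors[OF append_cols_carrier[OF A that]])
  have "vec_space.col_space d (B \<alpha>) \<subseteq> vec_space.col_space d A" if "\<alpha> \<in> {1..m}" for \<alpha>
    using pos_semidef_bordered_col_space[of A d m B n C, OF A B C G_psd _ that] A_psd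
    by (simp add: pos_semidef_def)
  then show ?thesis using col minors B by blast
qed

end
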